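(* Let $\kappa\in(0,1)$ and $\lambda=\sqrt{1-\kappa^2}$. Let $p=\wp(\bullet;g_2,g_3)$ be the Weierstrass function with invariants $g_2=\tfrac13(3\lambda^2+1)$ and $g_3=\tfrac1{27}(9\lambda^2-1)$, and let $P=\wp(\bullet;G_2,G_3)$ be the Weierstrass function with invariants $G_2=\tfrac{16}{3}(1+3\lambda^2)$ and $G_3=\tfrac{64}{27}(1-9\lambda^2)$. Then, as meromorphic functions of $z\in\mathbb{C}$, $$P(z)=-4\,p(2\,\mathrm{i}\,z).$$
   Context: The Weierstrass function $\wp(\bullet;g_2,g_3)$ is the one satisfying $(\wp')^2=4\wp^3-g_2\wp-g_3$ with a pole at $0$. *)

theory Defs
  imports "HOL-Complex_Analysis.Complex_Analysis"
begin

(* nicely_meromorphic_on selects, from each class of meromorphic functions that agree off their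
   singularities, the unique representative that has no removable singularities and takes the
   value 0 at its poles.  Equality of such representatives as HOL functions is therefore equality
   of meromorphic functions.  At a pole the values of f and deriv f are junk, so the differential
   equation is imposed at the other points only. *)
definition is_weierstrass_p :: "complex \<Rightarrow> complex \<Rightarrow> (complex \<Rightarrow> complex) \<Rightarrow> bool" where
  "is_weierstrass_p g2 g3 f \<longleftrightarrow>
     f nicely_meromorphic_on UNIV \<and> is_pole f 0 \<and>
     (\<forall>z. \<not> is_pole f z \<longrightarrow> (deriv f z)\<^sup>2 = 4 * f z ^ 3 - g2 * f z - g3)"

end

theory Submission
  imports Defs
begin

text \<open>
  The substitution \<open>z \<mapsto> 2 \<i> z\<close> together with the factor \<open>-4\<close> scales the invariants by
  \<open>16\<close> and \<open>-64\<close>, so everything rests on the fact that \<open>g\<^sub>2\<close> and \<open>g\<^sub>3\<close> determine the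
  function. The reciprocal \<open>u = 1 / \<wp>\<close> has a power series at \<open>0\<close> without constant term and
  satisfies \<open>u'\<^sup>2 = 4 u - g\<^sub>2 u\<^sup>3 - g\<^sub>3 u\<^sup>4\<close>. Hence \<open>u'(0) = 0\<close>, and differentiating and
  cancelling \<open>2 u'\<close> gives \<open>u'' = 2 - (3/2) g\<^sub>2 u\<^sup>2 - 2 g\<^sub>3 u\<^sup>3\<close>. The difference \<open>d\<close> of two
  solutions therefore satisfies \<open>d'' = d k\<close> with a power series \<open>k\<close>, and \<open>d(0) = d'(0) = 0\<close>
  forces \<open>d = 0\<close>. Two functions with the same invariants thus agree near \<open>0\<close>, hence everywhere.
\<close>

section \<open>Uniqueness for the reciprocal equation in formal power series\<close>

lemma fps_second_order_linear_unique:
  fixes d k :: "'a :: field_char_0 fps"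
  assumes ode: "fps_deriv (fps_deriv d) = d * k"
    and "fps_nth d 0 = 0" and "fps_nth d 1 = 0"
  shows "d = 0"
proof -
  have "fps_nth d n = 0" for n
  proof (induction n rule: less_induct)
    case (less n)
    show ?case
    proof (cases "n < 2")
      case True
      then show ?thesis using assms by (cases n) (auto simp: less_Suc_eq)
    next
      case False
      then obtain m where n: "n = Suc (Suc m)"
        by (metis Suc_1 add_2_eq_Suc le_iff_add not_less)
      \<comment> \<open>Coefficient \<open>m\<close> of \<open>d * k\<close> involves only
        coefficients of \<open>d\<close> up to \<open>m < n\<close>, which vanish by induction. The
        equation thus becomes a recurrence for coefficient \<open>n\<close>, whose factor
        \<open>(m + 1) * (m + 2)\<close> is nonzero in characteristic 0.\<close>
      have "fps_nth (d * k) m = 0"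
        using less n by (simp add: fps_mult_nth)
      moreover have "fps_nth (fps_deriv (fps_deriv d)) m = of_nat (Suc m) * of_nat (Suc (Suc m)) * fps_nth d n"
        by (simp add: n)
      ultimately have "of_nat (Suc m) * of_nat (Suc (Suc m)) * fps_nth d n = 0"
        using ode by simp
      then show ?thesis
        by (simp del: of_nat_Suc)
    qed
  qed
  then show ?thesis by (simp add: fps_eq_iff)
qed

lemma fps_reciprocal_wp_second_order:
  fixes U :: "'a :: field_char_0 fps"
  assumes ode: "(fps_deriv U)\<^sup>2 = 4 * U - fps_const g2 * U ^ 3 - fps_const g3 * U ^ 4"
    and U0: "fps_nth U 0 = 0" and "U \<noteq> 0"
  shows "fps_nth U 1 = 0"
    and "2 * fps_deriv (fps_deriv U) = 4 - 3 * fps_const g2 * U ^ 2 - 4 * fps_const g3 * U ^ 3"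
proof -
  have "fps_nth ((fps_deriv U)\<^sup>2) 0 = 0"
    using U0 by (simp add: ode fps_power_zeroth)
  then show "fps_nth U 1 = 0"
    by (simp add: fps_power_zeroth)
  \<comment> \<open>A nonzero series without constant term is not constant, so in characteristic 0
    its derivative is nonzero and can be cancelled below.\<close>
  have nz: "fps_deriv U \<noteq> 0"
    using U0 \<open>U \<noteq> 0\<close> by auto
  have "fps_deriv ((fps_deriv U)\<^sup>2)
      = fps_deriv (4 * U - fps_const g2 * U ^ 3 - fps_const g3 * U ^ 4)"
    using ode by simp
  then have "fps_deriv U * (2 * fps_deriv (fps_deriv U))
      = fps_deriv U * (4 - 3 * fps_const g2 * U ^ 2 - 4 * fps_const g3 * U ^ 3)"
    by (simp add: fps_deriv_power' algebra_simps)
  then show "2 * fps_deriv (fps_deriv U) = 4 - 3 * fps_const g2 * U ^ 2 - 4 * fps_const g3 * U ^ 3"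
    using nz by simp
qed

lemma fps_reciprocal_wp_unique:
  fixes U V :: "'a :: field_char_0 fps"
  assumes "(fps_deriv U)\<^sup>2 = 4 * U - fps_const g2 * U ^ 3 - fps_const g3 * U ^ 4"
    and "fps_nth U 0 = 0" and "U \<noteq> 0"
    and "(fps_deriv V)\<^sup>2 = 4 * V - fps_const g2 * V ^ 3 - fps_const g3 * V ^ 4"
    and "fps_nth V 0 = 0" and "V \<noteq> 0"
  shows "U = V"
proof -
  note u = fps_reciprocal_wp_second_order[OF assms(1-3)]
  note v = fps_reciprocal_wp_second_order[OF assms(4-6)]
  \<comment> \<open>The cofactor of \<open>U - V\<close> obtained by factoring
    \<open>U\<^sup>2 - V\<^sup>2\<close> and \<open>U ^ 3 - V ^ 3\<close> in the difference of the
    two second-order equations. It still carries the factor 2, which is divided out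
    afterwards.\<close>
  define K where
    "K = - 3 * fps_const g2 * (U + V) - 4 * fps_const g3 * (U\<^sup>2 + U * V + V\<^sup>2)"
  have "2 * fps_deriv (fps_deriv (U - V)) = (U - V) * K"
    using u(2) v(2) unfolding K_def
    by (simp add: algebra_simps power2_eq_square power3_eq_cube)
  then have "fps_const (1/2) * (2 * fps_deriv (fps_deriv (U - V))) = (U - V) * (fps_const (1/2) * K)"
    by (simp add: mult_ac)
  moreover have "fps_const (1/2) * (2 * X) = X" for X :: "'a fps"
    by (simp add: fps_eq_iff)
  ultimately have "fps_deriv (fps_deriv (U - V)) = (U - V) * (fps_const (1/2) * K)"
    by metis
  then have "U - V = 0"
    using u(1) v(1) assms(2,5) by (intro fps_second_order_linear_unique) auto
  then show ?thesis by simp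
qed

section \<open>From Laurent series with a pole to their reciprocals\<close>

lemma fls_wp_reciprocal:
  fixes F :: "'a :: field_char_0 fls"
  assumes ode: "(fls_deriv F)\<^sup>2 = 4 * F ^ 3 - fls_const g2 * F - fls_const g3"
    and "fls_subdegree F < 0"
  obtains U where "inverse F = fps_to_fls U" and "fps_nth U 0 = 0" and "U \<noteq> 0"
    and "(fps_deriv U)\<^sup>2 = 4 * U - fps_const g2 * U ^ 3 - fps_const g3 * U ^ 4"
proof
  \<comment> \<open>Negative subdegree of \<open>F\<close> means positive subdegree of
    \<open>inverse F\<close>, so the regular part is the whole series and its constant term is
    0.\<close>
  define U where "U = fls_regpart (inverse F)"
  have "F \<noteq> 0" using assms(2) by auto
  show U: "inverse F = fps_to_fls U"
    using assms(2) by (simp add: U_def)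
  show "fps_nth U 0 = 0"
    using assms(2) by (simp add: U_def)
  show "U \<noteq> 0"
    using U \<open>F \<noteq> 0\<close> by auto
  have four: "fps_to_fls (4 :: 'a fps) = 4"
    by (metis fps_numeral_fps_const fls_const_numeral fps_const_to_fls)
  \<comment> \<open>Since (1/F)' = -F'/F^2, multiplying the equation for \<open>F\<close> by F^(-4)
    gives the one for 1/F.\<close>
  have "(fls_deriv (inverse F))\<^sup>2 = (fls_deriv F)\<^sup>2 * inverse F ^ 4"
    by (simp add: fls_inverse_deriv power_mult_distrib)
  also have "\<dots> = 4 * inverse F - fls_const g2 * inverse F ^ 3 - fls_const g3 * inverse F ^ 4"
    using \<open>F \<noteq> 0\<close> unfolding ode by (simp add: field_simps power3_eq_cube power4_eq_xxxx)
  finally have "fps_to_fls ((fps_deriv U)\<^sup>2)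
      = fps_to_fls (4 * U - fps_const g2 * U ^ 3 - fps_const g3 * U ^ 4)"
    by (simp add: U fls_deriv_fps_to_fls fps_to_fls_power fls_times_fps_to_fls four)
  then show "(fps_deriv U)\<^sup>2 = 4 * U - fps_const g2 * U ^ 3 - fps_const g3 * U ^ 4"
    by (simp only: fps_to_fls_eq_iff)
qed

lemma fls_wp_unique:
  fixes F G :: "'a :: field_char_0 fls"
  assumes F: "(fls_deriv F)\<^sup>2 = 4 * F ^ 3 - fls_const g2 * F - fls_const g3" "fls_subdegree F < 0"
    and G: "(fls_deriv G)\<^sup>2 = 4 * G ^ 3 - fls_const g2 * G - fls_const g3" "fls_subdegree G < 0"
  shows "F = G"
proof -
  obtain U where U: "inverse F = fps_to_fls U" "fps_nth U 0 = 0" "U \<noteq> 0"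
    "(fps_deriv U)\<^sup>2 = 4 * U - fps_const g2 * U ^ 3 - fps_const g3 * U ^ 4"
    using fls_wp_reciprocal[OF F] by metis
  obtain V where V: "inverse G = fps_to_fls V" "fps_nth V 0 = 0" "V \<noteq> 0"
    "(fps_deriv V)\<^sup>2 = 4 * V - fps_const g2 * V ^ 3 - fps_const g3 * V ^ 4"
    using fls_wp_reciprocal[OF G] by metis
  have "U = V"
    using U V by (intro fps_reciprocal_wp_unique[of U g2 g3 V])
  then have "inverse F = inverse G" using U V by simp
  then show ?thesis by simp
qed

section \<open>Identity theorem for nicely meromorphic functions\<close>

lemma nicely_meromorphic_remove_sings:
  assumes "f nicely_meromorphic_on A" and "z \<in> A"
  shows "remove_sings f z = f z"
  using assms unfolding nicely_meromorphic_on_def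
  by (metis remove_sings_at_pole remove_sings_eqI)

text \<open>The identity theorem is applied to the difference. At a common pole of \<open>f\<close>
  and \<open>g\<close> the difference has value 0, which need not be its limit, so \<open>h\<close>
  first repairs the values at singularities.\<close>

lemma nicely_meromorphic_eqI:
  assumes f: "f nicely_meromorphic_on A" and g: "g nicely_meromorphic_on A"
    and A: "open A" "connected A" "a \<in> A"
    and ev: "eventually (\<lambda>z. f z = g z) (at a)" and "z \<in> A"
  shows "f z = g z"
proof -
  have mero: "(\<lambda>z. f z - g z) meromorphic_on A"
    using f g by (intro meromorphic_intros) (auto simp: nicely_meromorphic_on_def)
  define h where "h = remove_sings (\<lambda>z. f z - g z)"
  have h: "h nicely_meromorphic_on A"
    unfolding h_def using mero by (rule remove_sings_nicely_meromorphic)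
  have iso: "isolated_singularity_at (\<lambda>z. f z - g z) w" if "w \<in> A" for w
    using meromorphic_on_isolated_singularity[OF meromorphic_on_subset[OF mero, of "{w}"]] that
    by simp
  have "eventually (\<lambda>z. h z = 0) (at a)"
    using eventually_remove_sings_eq_at[OF iso[OF \<open>a \<in> A\<close>]] ev
    by eventually_elim (simp add: h_def)
  then have "frequently (\<lambda>z. h z = 0) (at a)"
    by (simp add: eventually_frequently)
  then have h0: "h w = 0" if "w \<in> A" for w
    using frequently_eq_meromorphic_imp_constant[OF _ h A] that by blast
  have "eventually (\<lambda>w. w \<in> A) (at z)"
    using A(1) \<open>z \<in> A\<close> by (intro eventually_at_in_open') auto
  then have "eventually (\<lambda>w. f w = g w) (at z)"
    using eventually_remove_sings_eq_at[OF iso[OF \<open>z \<in> A\<close>]]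
    by eventually_elim (use h0 in \<open>simp add: h_def\<close>)
  \<comment> \<open>\<open>remove_sings\<close> depends only on the punctured neighbourhood of
    \<open>z\<close> and fixes \<open>f\<close> and \<open>g\<close>, so this also settles the
    values at poles.\<close>
  then have "remove_sings f z = remove_sings g z"
    by (rule remove_sings_cong) simp
  then show ?thesis
    using nicely_meromorphic_remove_sings f g \<open>z \<in> A\<close> by metis
qed

section \<open>The invariants determine the Weierstrass function\<close>

lemma is_weierstrass_p_laurent:
  assumes "is_weierstrass_p g2 g3 f"
  obtains F where "f has_laurent_expansion F" and "fls_subdegree F < 0"
    and "(fls_deriv F)\<^sup>2 = 4 * F ^ 3 - fls_const g2 * F - fls_const g3"
proof -
  have nice: "f nicely_meromorphic_on UNIV" and pole: "is_pole f 0"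
    and ode: "\<And>z. \<not> is_pole f z \<Longrightarrow> (deriv f z)\<^sup>2 = 4 * f z ^ 3 - g2 * f z - g3"
    using assms by (auto simp: is_weierstrass_p_def)
  have mero: "f meromorphic_on UNIV"
    using nice by (simp add: nicely_meromorphic_on_def)
  then obtain F where "(\<lambda>w. f (0 + w)) has_laurent_expansion F"
    unfolding meromorphic_on_def by blast
  then have F: "f has_laurent_expansion F" by simp
  \<comment> \<open>The equation is known only off the poles. These do not accumulate at 0, so it
    holds on a punctured neighbourhood, which is all that a Laurent expansion sees.\<close>
  have "eventually (\<lambda>z. \<not> is_pole f z) (at 0)"
    using meromorphic_on_imp_not_pole_cosparse[OF mero]
    by (simp add: eventually_cosparse_open_eq)
  then have ev: "eventually (\<lambda>z. (deriv f z)\<^sup>2 = 4 * f z ^ 3 - g2 * f z - g3) (at 0)"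
    by eventually_elim (rule ode)
  have "(\<lambda>z. (deriv f z)\<^sup>2) has_laurent_expansion (fls_deriv F)\<^sup>2"
    by (intro laurent_expansion_intros F)
  moreover have "(\<lambda>z. 4 * f z ^ 3 - g2 * f z - g3) has_laurent_expansion
      fls_const 4 * F ^ 3 - fls_const g2 * F - fls_const g3"
    by (intro laurent_expansion_intros F)
  ultimately have "(fls_deriv F)\<^sup>2 = fls_const 4 * F ^ 3 - fls_const g2 * F - fls_const g3"
    using has_laurent_expansion_cong[OF ev refl] has_laurent_expansion_unique by blast
  with F pole show thesis
    by (intro that[of F]) (simp_all add: is_pole_0_imp_neg_fls_subdegree)
qed

lemma is_weierstrass_p_unique:
  assumes f: "is_weierstrass_p g2 g3 f" and g: "is_weierstrass_p g2 g3 g"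
  shows "f = g"
proof
  fix z
  obtain F where F: "f has_laurent_expansion F" "fls_subdegree F < 0"
    "(fls_deriv F)\<^sup>2 = 4 * F ^ 3 - fls_const g2 * F - fls_const g3"
    by (rule is_weierstrass_p_laurent[OF f])
  obtain G where G: "g has_laurent_expansion G" "fls_subdegree G < 0"
    "(fls_deriv G)\<^sup>2 = 4 * G ^ 3 - fls_const g2 * G - fls_const g3"
    by (rule is_weierstrass_p_laurent[OF g])
  have "F = G"
    by (rule fls_wp_unique[OF F(3,2) G(3,2)])
  then have "(\<lambda>z. f z - g z) has_laurent_expansion 0"
    using has_laurent_expansion_diff[OF F(1) G(1)] by simp
  then have "eventually (\<lambda>z. f z = g z) (at 0)"
    using has_laurent_expansion_eventually_zero_iff[of "\<lambda>z. f z - g z" 0 0] by simp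
  then show "f z = g z"
    using f g by (intro nicely_meromorphic_eqI[of f UNIV g 0]) (auto simp: is_weierstrass_p_def)
qed

section \<open>Scaling of the argument\<close>

lemma filtermap_times_at:
  fixes c :: "'a :: real_normed_field"
  assumes "c \<noteq> 0"
  shows "filtermap (\<lambda>w. c * w) (at z) = at (c * z)"
proof (rule filtermap_fun_inverse)
  show "filterlim (\<lambda>w. w / c) (at z) (at (c * z))"
    using assms by (auto intro!: filterlim_atI tendsto_eq_intros simp: eventually_at_filter field_simps)
  show "filterlim (\<lambda>w. c * w) (at (c * z)) (at z)"
    using assms by (auto intro!: filterlim_atI tendsto_eq_intros simp: eventually_at_filter)
qed (use assms in auto)

lemma nicely_meromorphic_scale:
  assumes f: "f nicely_meromorphic_on UNIV" and "c \<noteq> 0"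
  shows "(\<lambda>z. f (c * z)) nicely_meromorphic_on UNIV"
proof -
  have filt: "filtermap (\<lambda>w. c * w) (at z) = at (c * z)" for z
    using \<open>c \<noteq> 0\<close> by (rule filtermap_times_at)
  have "(\<lambda>z. f (c * z)) meromorphic_on UNIV"
    using f by (intro meromorphic_on_compose[of f UNIV "\<lambda>z. c * z"] analytic_intros)
      (auto simp: nicely_meromorphic_on_def)
  moreover have "(is_pole (\<lambda>z. f (c * z)) z \<and> f (c * z) = 0) \<or> (\<lambda>z. f (c * z)) \<midarrow>z\<rightarrow> f (c * z)" for z
  proof -
    have "(is_pole f (c * z) \<and> f (c * z) = 0) \<or> f \<midarrow>c * z\<rightarrow> f (c * z)"
      using f by (auto simp: nicely_meromorphic_on_def)
    \<comment> \<open>Poles and limits are both expressed through the punctured filter, so rewriting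
      that filter carries over both alternatives at once.\<close>
    then show ?thesis
      unfolding is_pole_def filt[symmetric] filterlim_filtermap .
  qed
  ultimately show ?thesis by (simp add: nicely_meromorphic_on_def)
qed

text \<open>Classical homogeneity: the new function gains c^2 and its derivative c^3, so with
  weights 4 and 6 for the invariants every term of the differential equation is multiplied by
  c^6.\<close>

lemma is_weierstrass_p_homogeneous:
  assumes f: "is_weierstrass_p g2 g3 f" and "c \<noteq> 0"
  shows "is_weierstrass_p (c ^ 4 * g2) (c ^ 6 * g3) (\<lambda>z. c\<^sup>2 * f (c * z))"
  unfolding is_weierstrass_p_def
proof (intro conjI allI impI)
  have nice: "f nicely_meromorphic_on UNIV" and pole: "is_pole f 0"
    and ode: "\<And>z. \<not> is_pole f z \<Longrightarrow> (deriv f z)\<^sup>2 = 4 * f z ^ 3 - g2 * f z - g3"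
    using f by (auto simp: is_weierstrass_p_def)
  have poles: "is_pole (\<lambda>z. c\<^sup>2 * f (c * z)) z \<longleftrightarrow> is_pole f (c * z)" for z
    using is_pole_compose_iff[OF filtermap_times_at[OF \<open>c \<noteq> 0\<close>], of f z] \<open>c \<noteq> 0\<close>
    by (simp add: o_def)
  show "(\<lambda>z. c\<^sup>2 * f (c * z)) nicely_meromorphic_on UNIV"
    by (intro nicely_meromorphic_on_cmult_left nicely_meromorphic_scale nice \<open>c \<noteq> 0\<close>)
  show "is_pole (\<lambda>z. c\<^sup>2 * f (c * z)) 0"
    using pole by (simp add: poles)
  fix z
  assume "\<not> is_pole (\<lambda>z. c\<^sup>2 * f (c * z)) z"
  then have np: "\<not> is_pole f (c * z)" by (simp add: poles)
  then have "f analytic_on {c * z}"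
    using nicely_meromorphic_on_imp_analytic_at[OF nice] by simp
  then have "(f has_field_derivative deriv f (c * z)) (at (c * z))"
    using analytic_on_imp_differentiable_at DERIV_deriv_iff_field_differentiable by blast
  then have "((\<lambda>z. c\<^sup>2 * f (c * z)) has_field_derivative c\<^sup>2 * (deriv f (c * z) * c)) (at z)"
    by (auto intro!: derivative_eq_intros DERIV_chain2[of f])
  then have "deriv (\<lambda>z. c\<^sup>2 * f (c * z)) z = c ^ 3 * deriv f (c * z)"
    by (simp add: DERIV_imp_deriv power2_eq_square power3_eq_cube)
  then have "(deriv (\<lambda>z. c\<^sup>2 * f (c * z)) z)\<^sup>2 = c ^ 6 * (4 * f (c * z) ^ 3 - g2 * f (c * z) - g3)"
    using ode[OF np] by (simp add: power_mult_distrib)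
  also have "\<dots> = 4 * (c\<^sup>2 * f (c * z)) ^ 3 - c ^ 4 * g2 * (c\<^sup>2 * f (c * z)) - c ^ 6 * g3"
    by algebra
  finally show "(deriv (\<lambda>z. c\<^sup>2 * f (c * z)) z)\<^sup>2
      = 4 * (c\<^sup>2 * f (c * z)) ^ 3 - c ^ 4 * g2 * (c\<^sup>2 * f (c * z)) - c ^ 6 * g3" .
qed

theorem theorem10:
  fixes kappa lam :: real and p P :: "complex \<Rightarrow> complex"
  assumes "0 < kappa" and "kappa < 1"
    and "lam = sqrt (1 - kappa\<^sup>2)"
    and "is_weierstrass_p (of_real (1 / 3 * (3 * lam\<^sup>2 + 1))) (of_real (1 / 27 * (9 * lam\<^sup>2 - 1))) p"
    and "is_weierstrass_p (of_real (16 / 3 * (1 + 3 * lam\<^sup>2))) (of_real (64 / 27 * (1 - 9 * lam\<^sup>2))) P"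
  shows "\<forall>z. P z = - 4 * p (2 * \<i> * z)"
proof -
  \<comment> \<open>The square is the required prefactor. The other two powers are the ratios of the
    invariants of \<open>P\<close> to those of \<open>p\<close>; the negative one turns
    \<open>9 * lam\<^sup>2 - 1\<close> into \<open>1 - 9 * lam\<^sup>2\<close>.\<close>
  have c: "(2 * \<i>)\<^sup>2 = - 4" "(2 * \<i>) ^ 4 = 16" "(2 * \<i>) ^ 6 = - 64"
    by (simp_all add: power_mult_distrib power2_eq_square eval_nat_numeral)
  have "16 * of_real (1 / 3 * (3 * lam\<^sup>2 + 1)) = complex_of_real (16 / 3 * (1 + 3 * lam\<^sup>2))"
    and "- 64 * of_real (1 / 27 * (9 * lam\<^sup>2 - 1)) = complex_of_real (64 / 27 * (1 - 9 * lam\<^sup>2))"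
    by (simp_all add: field_simps)
  note invariants = this
  have "is_weierstrass_p (of_real (16 / 3 * (1 + 3 * lam\<^sup>2))) (of_real (64 / 27 * (1 - 9 * lam\<^sup>2)))
      (\<lambda>z. - 4 * p (2 * \<i> * z))"
    using is_weierstrass_p_homogeneous[OF assms(4), of "2 * \<i>", unfolded c invariants] by simp
  from is_weierstrass_p_unique[OF assms(5) this] show ?thesis
    by metis
qed

end
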